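(* Assume that some $n\times 2$ scenario with no input, $F=(\emptyset,\mathcal Y,\$)$, is furnished with some EWL-type procedure $P$, where the actions of the players are defined through their choices of local unitary operators $U_1,\dots,U_n$. Then procedure $P$ within scenario $F$ is an implementation of some static (possibly continuous) $n$-player game, which has at least one Nash equilibrium.
   Context: An $n\times k$ scenario is a triple $(\mathcal X,\mathcal Y,\$)$, where $\mathcal X,\mathcal Y\subseteq\{0,\dots,k-1\}^n$ are the valid inputs and outputs and $\$=(\$_1,\dots,\$_n)$ is an evaluating function, with $\$_i:\mathcal X\times\mathcal Y\to\mathbb R$. Here $k=2$. A scenario with no input is one with $\mathcal X=\emptyset$; in that case $\$_i$ is regarded as a real-valued function $\$_i(y_1,\dots,y_n)$ of the output alone. An EWL-type (Eisert–Wilkens–Lewenstein) procedure is given by a five-tuple $P=(n,H,J,\rho,\mathfrak U)$, where $n$ is the number of players, $H,J$ are unitary operators on $(\mathbb C^2)^{\otimes n}$, $\rho$ is an initial $n$-qubit state, and $\mathfrak U$ is a compact subset of $\mathsf{SU}(2)$. With no input, player $i$ acts by choosing an operator $U_i\in\mathfrak U$. Put $\mathcal U=U_1\otimes\cdots\otimes U_n$ and $\rho_f=H\,\mathcal U\,J\,\rho\,(H\,\mathcal U\,J)^\dagger$. The final state $\rho_f$ is measured in the standard basis and the result is the output: with $Q_0=|0\rangle\langle 0|$ and $Q_1=|1\rangle\langle 1|$, $$\operatorname{Pr}[Y=(y_1,\dots,y_n)\mid U_1,\dots,U_n]=\operatorname{Tr}\bigl((Q_{y_1}\otimes\cdots\otimes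 Q_{y_n})\,\rho_f\bigr).$$ A static game is given by a set of players, their sets of strategies, and their payoff functions. An implementation of a game is a physical system in which strategies are represented by transformations on the system and payoffs by results of an appropriate measurement performed on it; here the transformations are the players' choices of $U_i\in\mathfrak U$, and the payoff of player $i$ is the expected value of $\$_i$ at the measured output. "Continuous" refers to a game with infinite (compact) strategy sets and continuous payoff functions. A Nash equilibrium is a strategy profile in which no player can increase their own payoff by unilaterally changing strategy; it is understood to be possibly in mixed strategies, that is, probability measures on the set of pure strategies, with payoffs taken in expectation. *)

theory Defs
  imports "HOL-Probability.Probability"
begin

text \<open>The players are the elements of a finite type \<open>'n\<close>, so that \<open>n = CARD('n)\<close>, and the letters
  \<open>0, \<dots>, k - 1\<close> are the elements of a finite type \<open>'k\<close>; for \<open>k = 2\<close> this is the numeral type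
  \<open>2\<close> with elements \<open>0\<close> and \<open>1\<close>. An \<open>n\<close>-tuple of letters is a vector of type \<open>'k ^ 'n\<close>.\<close>

text \<open>For a valid input \<open>x\<close>, \<open>evaluation F i (Some x) y\<close> is the value of the \<open>i\<close>-th evaluating function at
  \<open>(x, y)\<close>. If there are no inputs, the evaluating functions depend on the output alone, and
  \<open>evaluation F i None y\<close> is the value at \<open>y\<close>. Only values at valid outputs are meaningful.\<close>

record ('k, 'n) scenario =
  inputs :: "('k::finite ^ 'n::finite) set"
  outputs :: "('k ^ 'n) set"
  evaluation :: "'n \<Rightarrow> ('k ^ 'n) option \<Rightarrow> 'k ^ 'n \<Rightarrow> real"

definition no_input :: "('k::finite, 'n::finite) scenario \<Rightarrow> bool" where
  "no_input F \<longleftrightarrow> inputs F = {}"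

definition dagger :: "complex ^ 'a ^ 'b \<Rightarrow> complex ^ 'b ^ 'a" where
  "dagger A = (\<chi> i j. cnj (A $ j $ i))"

definition unitary_matrix :: "complex ^ 'a ^ 'a \<Rightarrow> bool" where
  "unitary_matrix A \<longleftrightarrow> A ** dagger A = mat 1 \<and> dagger A ** A = mat 1"

definition SU2 :: "(complex ^ 2 ^ 2) set" where
  "SU2 = {U. unitary_matrix U \<and> det U = 1}"

definition density_operator :: "complex ^ 'a ^ 'a \<Rightarrow> bool" where
  "density_operator A \<longleftrightarrow>
     dagger A = A \<and>
     (\<forall>v. 0 \<le> Re (\<Sum>i\<in>UNIV. cnj (v $ i) * (A *v v) $ i)) \<and>
     trace A = 1"

text \<open>The standard basis of the \<open>n\<close>-fold tensor power of the qubit space is indexed by the bit strings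
  in \<open>2 ^ 'n\<close>; the tensor factors are labelled by the players.\<close>

type_synonym 'n qubits_op = "complex ^ (2 ^ 'n) ^ (2 ^ 'n)"

definition tensor :: "('n \<Rightarrow> complex ^ 2 ^ 2) \<Rightarrow> 'n::finite qubits_op" where
  "tensor U = (\<chi> x y. \<Prod>i\<in>UNIV. U i $ (x $ i) $ (y $ i))"

definition basis_projector :: "2 \<Rightarrow> complex ^ 2 ^ 2" where
  "basis_projector b = (\<chi> i j. if i = b \<and> j = b then 1 else 0)"

text \<open>\<open>post_op\<close> and \<open>pre_op\<close> are the unitaries applied after (\<open>H\<close>) and before (\<open>J\<close>) the players'
  operators, which are chosen from \<open>moves\<close>.\<close>

record 'n ewl =
  post_op :: "'n::finite qubits_op"
  pre_op :: "'n qubits_op"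
  init_state :: "'n qubits_op"
  moves :: "(complex ^ 2 ^ 2) set"

definition ewl_procedure :: "'n::finite ewl \<Rightarrow> bool" where
  "ewl_procedure P \<longleftrightarrow>
     unitary_matrix (post_op P) \<and> unitary_matrix (pre_op P) \<and>
     density_operator (init_state P) \<and>
     moves P \<subseteq> SU2 \<and> compact (moves P) \<and> moves P \<noteq> {}"

definition final_state :: "'n::finite ewl \<Rightarrow> ('n \<Rightarrow> complex ^ 2 ^ 2) \<Rightarrow> 'n qubits_op" where
  "final_state P U =
     (let W = post_op P ** tensor U ** pre_op P in W ** init_state P ** dagger W)"

text \<open>The trace is real because the final state is again a density operator; \<open>Re\<close> only changes the
  type.\<close>

definition outcome_prob ::
  "'n::finite ewl \<Rightarrow> ('n \<Rightarrow> complex ^ 2 ^ 2) \<Rightarrow> 2 ^ 'n \<Rightarrow> real" where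
  "outcome_prob P U y = Re (trace (tensor (\<lambda>i. basis_projector (y $ i)) ** final_state P U))"

text \<open>Results outside the set of valid outputs, where the evaluating functions are not defined,
  contribute nothing.\<close>

definition expected_evaluation ::
  "(2, 'n::finite) scenario \<Rightarrow> 'n ewl \<Rightarrow> 'n \<Rightarrow> ('n \<Rightarrow> complex ^ 2 ^ 2) \<Rightarrow> real" where
  "expected_evaluation F P i U = (\<Sum>y\<in>outputs F. evaluation F i None y * outcome_prob P U y)"

text \<open>Only payoffs at profiles of strategies are meaningful.\<close>

record ('n, 's) static_game =
  strategies :: "'n::finite \<Rightarrow> 's::topological_space set"
  payoff :: "'n \<Rightarrow> ('n \<Rightarrow> 's) \<Rightarrow> real"

definition profiles :: "('n::finite, 's::topological_space) static_game \<Rightarrow> ('n \<Rightarrow> 's) set" where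
  "profiles G = {s. \<forall>i. s i \<in> strategies G i}"

definition finite_game :: "('n::finite, 's::topological_space) static_game \<Rightarrow> bool" where
  "finite_game G \<longleftrightarrow> (\<forall>i. finite (strategies G i))"

definition continuous_game :: "('n::finite, 's::topological_space) static_game \<Rightarrow> bool" where
  "continuous_game G \<longleftrightarrow>
     (\<forall>i. infinite (strategies G i) \<and> compact (strategies G i)) \<and>
     (\<forall>i. continuous_on (profiles G) (payoff G i))"

definition mixed_strategy ::
  "('n::finite, 's::topological_space) static_game \<Rightarrow> 'n \<Rightarrow> 's measure \<Rightarrow> bool" where
  "mixed_strategy G i \<mu> \<longleftrightarrow>
     prob_space \<mu> \<and> sets \<mu> = sets (restrict_space borel (strategies G i))"

text \<open>The Bochner integral is the intended expectation when the payoff is integrable for the product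
  measure; in particular for finite games on Hausdorff spaces and for continuous games on
  second-countable spaces.\<close>

definition mixed_payoff ::
  "('n::finite, 's::topological_space) static_game \<Rightarrow> 'n \<Rightarrow> ('n \<Rightarrow> 's measure) \<Rightarrow> real" where
  "mixed_payoff G i \<mu> = (\<integral>s. payoff G i s \<partial>(\<Pi>\<^sub>M j\<in>UNIV. \<mu> j))"

definition nash_equilibrium ::
  "('n::finite, 's::topological_space) static_game \<Rightarrow> ('n \<Rightarrow> 's measure) \<Rightarrow> bool" where
  "nash_equilibrium G \<mu> \<longleftrightarrow>
     (\<forall>i. mixed_strategy G i (\<mu> i)) \<and>
     (\<forall>i \<nu>. mixed_strategy G i \<nu> \<longrightarrow> mixed_payoff G i (\<mu>(i := \<nu>)) \<le> mixed_payoff G i \<mu>)"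

text \<open>Player \<open>j\<close>'s strategy \<open>s\<close> is represented by the operator \<open>r j s\<close>. Every admissible operator
  represents exactly one strategy, and the representation preserves the topology, on which
  continuity of payoffs and the mixed strategies depend.\<close>

definition implements ::
  "'n::finite ewl \<Rightarrow> (2, 'n) scenario \<Rightarrow> ('n, 's::topological_space) static_game \<Rightarrow> bool" where
  "implements P F G \<longleftrightarrow>
     (\<exists>r. (\<forall>j. \<exists>r'. homeomorphism (strategies G j) (moves P) (r j) r') \<and>
          (\<forall>i. \<forall>s\<in>profiles G. payoff G i s = expected_evaluation F P i (\<lambda>j. r j (s j))))"

end

theory Submission imports Defs begin

text \<open>The payoffs depend on player \<open>i\<close>'s operator \<open>U\<close> only through the products \<open>U\<^sub>a\<^sub>b cnj U\<^sub>c\<^sub>d\<close>, and linearly in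
  these for every player. A mixed strategy therefore matters only through the barycentre of these products, a
  point of the convex hull \<open>K\<close> of a compact set in a finite-dimensional space, and every point of \<open>K\<close> is the
  barycentre of a finitely supported measure. For a game on \<open>K\<close> with payoffs linear in each player's own
  strategy, an equilibrium is a fixed point of the map that moves every player along the gradient of their
  payoff and projects back to \<open>K\<close>; Brouwer's theorem provides one.\<close>

section \<open>Equilibria for payoffs linear in each player's own strategy\<close>

lemma compact_vec_box:
  fixes K :: "'n::finite \<Rightarrow> 'a::euclidean_space set"
  assumes "\<And>i. compact (K i)"
  shows "compact {X :: 'a ^ 'n. \<forall>i. X $ i \<in> K i}"
proof -
  have "\<exists>B. \<forall>x\<in>K i. norm x \<le> B" for i
    using assms compact_imp_bounded bounded_iff by blast
  then obtain B where B: "\<And>i x. x \<in> K i \<Longrightarrow> norm x \<le> B i" by metis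
  have "norm X \<le> (\<Sum>i\<in>UNIV. B i)" if "\<forall>i. X $ i \<in> K i" for X :: "'a ^ 'n"
  proof -
    have "norm X \<le> (\<Sum>i\<in>UNIV. norm (X $ i))"
      unfolding norm_vec_def by (rule L2_set_le_sum) auto
    also have "\<dots> \<le> (\<Sum>i\<in>UNIV. B i)"
      using that B by (intro sum_mono) auto
    finally show ?thesis .
  qed
  then have "bounded {X :: 'a ^ 'n. \<forall>i. X $ i \<in> K i}"
    unfolding bounded_iff by blast
  moreover have "closed {X :: 'a ^ 'n. \<forall>i. X $ i \<in> K i}"
  proof (intro closed_Collect_all)
    fix i
    have "closed ((\<lambda>X :: 'a ^ 'n. X $ i) -` K i)"
      using assms by (intro closed_vimage continuous_intros compact_imp_closed)
    then show "closed {X :: 'a ^ 'n. X $ i \<in> K i}" by (simp add: vimage_def)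
  qed
  ultimately show ?thesis by (simp add: compact_eq_bounded_closed)
qed

text \<open>At a fixed point of the projected gradient map, each \<open>x i\<close> is the point of
  \<open>K i\<close> nearest to \<open>x i\<close> plus the gradient, so the gradient makes no acute
  angle with a direction from \<open>x i\<close> into \<open>K i\<close>. Linearity in the own
  strategy turns this local condition into optimality over all of \<open>K i\<close>.\<close>

lemma linear_payoff_equilibrium:
  fixes K :: "'n::finite \<Rightarrow> 'a::euclidean_space set" and f :: "'n \<Rightarrow> ('n \<Rightarrow> 'a) \<Rightarrow> real"
  assumes K: "\<And>i. compact (K i)" "\<And>i. convex (K i)" "\<And>i. K i \<noteq> {}"
    and cont: "\<And>i. continuous_on UNIV (f i)"
    and lin: "\<And>i x. linear (\<lambda>v. f i (x(i := v)))"
  shows "\<exists>x. (\<forall>i. x i \<in> K i) \<and> (\<forall>i. \<forall>v\<in>K i. f i (x(i := v)) \<le> f i x)"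
proof -
  \<comment> \<open>The gradient of player \<open>i\<close>'s payoff in the own strategy: the vector
    representing the functional \<open>v \<mapsto> f i (x(i := v))\<close>. It does not depend on
    \<open>X $ i\<close>.\<close>
  define g where "g i X = (\<Sum>b\<in>Basis. f i ((($) X)(i := b)) *\<^sub>R b)" for i and X :: "'a ^ 'n"
  have g: "g i X \<bullet> v = f i ((($) X)(i := v))" for i X v
  proof -
    interpret linear "\<lambda>v. f i ((($) X)(i := v))" by (rule lin)
    have "f i ((($) X)(i := v)) = f i ((($) X)(i := \<Sum>b\<in>Basis. (v \<bullet> b) *\<^sub>R b))"
      by (simp only: euclidean_representation)
    also have "\<dots> = (\<Sum>b\<in>Basis. (v \<bullet> b) * f i ((($) X)(i := b)))"
      by (simp add: sum scale)
    also have "\<dots> = g i X \<bullet> v"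
      by (simp add: g_def inner_sum_left inner_commute[of v] mult.commute)
    finally show ?thesis by simp
  qed
  have contg: "continuous_on S (g i)" for S i
    unfolding g_def
  proof (intro continuous_intros)
    fix b
    have "continuous_on S (\<lambda>X :: 'a ^ 'n. ((($) X)(i := b)))"
    proof (rule continuous_on_coordinatewise_then_product)
      fix j show "continuous_on S (\<lambda>X :: 'a ^ 'n. ((($) X)(i := b)) j)"
        by (cases "j = i") (auto intro!: continuous_intros)
    qed
    then show "continuous_on S (\<lambda>X. f i ((($) X)(i := b)))"
      by (rule continuous_on_compose2[OF cont]) auto
  qed
  \<comment> \<open>Profiles are packed into single vectors so that Brouwer's theorem for Euclidean
    spaces applies.\<close>
  define S where "S = {X :: 'a ^ 'n. \<forall>i. X $ i \<in> K i}"
  define T where "T X = (\<chi> i. closest_point (K i) (X $ i + g i X))" for X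
  have "\<exists>x. x \<in> K i" for i using K(3) by blast
  then obtain X0 where "\<And>i. X0 i \<in> K i" by metis
  then have ne: "S \<noteq> {}" by (auto simp: S_def intro!: exI[of _ "\<chi> i. X0 i"])
  have cl: "closed (K i)" for i using K(1) by (rule compact_imp_closed)
  have "convex S"
    unfolding S_def convex_def using K(2) by (simp add: convexD)
  moreover have "continuous_on S T"
    unfolding T_def
  proof (intro continuous_on_vec_lambda)
    fix i
    show "continuous_on S (\<lambda>X. closest_point (K i) (X $ i + g i X))"
      by (rule continuous_on_compose2[OF continuous_on_closest_point[OF K(2) cl K(3), where t = UNIV]])
        (auto intro!: continuous_intros contg)
  qed
  moreover have "T \<in> S \<rightarrow> S"
    by (simp add: S_def T_def closest_point_in_set cl K(3))
  ultimately obtain X where X: "X \<in> S" "T X = X"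
    using brouwer[of S T] compact_vec_box[of K] K(1) ne unfolding S_def[symmetric] by auto
  have "f i ((($) X)(i := v)) \<le> f i (($) X)" if v: "v \<in> K i" for i v
  proof -
    have "closest_point (K i) (X $ i + g i X) = X $ i"
      using X(2) unfolding T_def by (metis vec_lambda_beta)
    \<comment> \<open>The variational inequality of the nearest point; the point being projected
      minus its projection is exactly \<open>g i X\<close>.\<close>
    then have "g i X \<bullet> (v - X $ i) \<le> 0"
      using closest_point_dot[OF K(2) cl v, of "X $ i + g i X"] by simp
    then show ?thesis
      by (simp add: inner_diff_right g)
  qed
  then show ?thesis
    using X(1) by (intro exI[of _ "($) X"]) (auto simp: S_def)
qed

section \<open>Points of a convex hull as barycentres of measures\<close>

text \<open>A convex combination of values of \<phi> is the integral of \<phi> against the measure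
  that puts the coefficients as weights on preimages of these values.\<close>

lemma convex_hull_barycentre:
  fixes \<phi> :: "'a::topological_space \<Rightarrow> 'b::euclidean_space"
  assumes "v \<in> convex hull (\<phi> ` A)" and \<phi>: "\<phi> \<in> borel_measurable borel"
  shows "\<exists>\<mu>. prob_space \<mu> \<and> sets \<mu> = sets (restrict_space borel A) \<and> (\<integral>s. \<phi> s \<partial>\<mu>) = v"
proof -
  obtain k :: nat and u y where y: "\<And>i. i \<in> {1..k} \<Longrightarrow> 0 \<le> u i \<and> y i \<in> \<phi> ` A" "sum u {1..k} = 1"
      "(\<Sum>i=1..k. u i *\<^sub>R y i) = v"
    using assms(1) unfolding convex_hull_indexed by blast
  obtain a where a: "a \<in> A" using assms(1) by (cases "A = {}") auto
  \<comment> \<open>The default \<open>a\<close> keeps \<open>z\<close> inside \<open>A\<close> on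
    all of the naturals, so that it is measurable into the restricted space.\<close>
  define z where "z i = (if i \<in> {1..k} then SOME s. s \<in> A \<and> \<phi> s = y i else a)" for i
  have z: "z i \<in> A \<and> (i \<in> {1..k} \<longrightarrow> \<phi> (z i) = y i)" for i
  proof (cases "i \<in> {1..k}")
    case True
    then have "\<exists>s. s \<in> A \<and> \<phi> s = y i" using y(1)[of i] by auto
    from someI_ex[OF this] show ?thesis using True by (simp add: z_def)
  qed (auto simp: z_def a)
  \<comment> \<open>The weights sit on indices, because the points \<open>z i\<close> may coincide;
    the push-forward along \<open>z\<close> then adds up their weights.\<close>
  define p where "p = embed_pmf (\<lambda>i. if i \<in> {1..k} then u i else 0)"
  have p: "pmf p i = (if i \<in> {1..k} then u i else 0)" for i
    unfolding p_def
  proof (rule pmf_embed_pmf)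
    have "(\<integral>\<^sup>+ i. ennreal (if i \<in> {1..k} then u i else 0) \<partial>count_space UNIV)
        = (\<Sum>i=1..k. ennreal (if i \<in> {1..k} then u i else 0))"
      by (rule nn_integral_count_space') auto
    also have "\<dots> = ennreal (sum u {1..k})"
      using y(1) by (subst sum_ennreal[symmetric]) auto
    finally show "(\<integral>\<^sup>+ i. ennreal (if i \<in> {1..k} then u i else 0) \<partial>count_space UNIV) = 1"
      using y(2) by simp
  qed (use y(1) in auto)
  have zm: "z \<in> measurable (measure_pmf p) (restrict_space borel A)"
    using z by (auto simp: measurable_def space_restrict_space)
  define \<mu> where "\<mu> = distr (measure_pmf p) (restrict_space borel A) z"
  have "(\<integral>s. \<phi> s \<partial>\<mu>) = (\<integral>i. \<phi> (z i) \<partial>measure_pmf p)"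
    unfolding \<mu>_def by (rule integral_distr[OF zm]) (rule measurable_restrict_space1[OF \<phi>])
  also have "\<dots> = (\<Sum>i=1..k. pmf p i *\<^sub>R \<phi> (z i))"
    by (rule integral_measure_pmf) (auto simp: set_pmf_iff p split: if_splits)
  also have "\<dots> = v" using z p by (simp flip: y(3))
  finally show ?thesis
    by (intro exI[of _ \<mu>]) (auto simp: \<mu>_def intro!: measure_pmf.prob_space_distr zm)
qed

section \<open>Multilinear forms in the products of operator entries\<close>

text \<open>The tensor product of \<open>U\<close> with its entrywise conjugate. Its entries are the
  coefficients of the map \<rho> \<mapsto> \<open>U \<rho> U\<^sup>\<dagger>\<close>.\<close>

definition quad :: "complex ^ 2 ^ 2 \<Rightarrow> complex ^ 2 ^ 2 ^ 2 ^ 2" where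
  "quad U = (\<chi> a b c d. U $ a $ b * cnj (U $ c $ d))"

text \<open>The arguments range over the whole tensor space, so that averages of \<open>quad\<close>
  can be inserted, which need not be of the form \<open>quad U\<close>. Player \<open>j\<close>
  contributes the entry selected by the \<open>j\<close>-th bits of the four strings.\<close>

definition multilinear_form ::
  "(2 ^ 'n \<Rightarrow> 2 ^ 'n \<Rightarrow> 2 ^ 'n \<Rightarrow> 2 ^ 'n \<Rightarrow> complex) \<Rightarrow> ('n::finite \<Rightarrow> complex ^ 2 ^ 2 ^ 2 ^ 2) \<Rightarrow> real" where
  "multilinear_form C X =
     Re (\<Sum>a\<in>UNIV. \<Sum>b\<in>UNIV. \<Sum>c\<in>UNIV. \<Sum>d\<in>UNIV.
       C a b c d * (\<Prod>j\<in>UNIV. X j $ (a $ j) $ (b $ j) $ (c $ j) $ (d $ j)))"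

lemma continuous_on_multilinear_form: "continuous_on S (multilinear_form C)"
  unfolding multilinear_form_def
  by (intro continuous_intros continuous_on_subset[OF continuous_on_product_coordinates]) auto

text \<open>Every monomial contains exactly one factor that comes from player
  \<open>i\<close>.\<close>

lemma linear_multilinear_form: "linear (\<lambda>v. multilinear_form C (X(i := v)))"
proof -
  have *: "(\<Prod>j\<in>UNIV. (X(i := v)) j $ (a $ j) $ (b $ j) $ (c $ j) $ (d $ j)) =
     v $ (a $ i) $ (b $ i) $ (c $ i) $ (d $ i) *
       (\<Prod>j\<in>UNIV - {i}. X j $ (a $ j) $ (b $ j) $ (c $ j) $ (d $ j))" for v a b c d
    by (subst prod.remove[of _ i]) (auto intro!: prod.cong)
  show ?thesis
    unfolding multilinear_form_def *
    by (rule linearI)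
      (simp_all add: algebra_simps sum.distrib flip: scaleR_sum_right)
qed

lemma continuous_on_quad: "continuous_on S quad"
  unfolding quad_def by (intro continuous_intros)

lemma borel_measurable_quad: "quad \<in> borel_measurable borel"
  by (intro borel_measurable_continuous_onI continuous_on_quad)

lemma integrable_quad:
  assumes "compact A" "prob_space \<mu>" "sets \<mu> = sets (restrict_space borel A)"
  shows "integrable \<mu> quad"
proof -
  interpret prob_space \<mu> by fact
  have "space \<mu> = A"
    using sets_eq_imp_space_eq[OF assms(3)] by (simp add: space_restrict_space)
  moreover obtain B where "\<And>s. s \<in> A \<Longrightarrow> norm (quad s) \<le> B"
    using compact_imp_bounded[OF compact_continuous_image[OF continuous_on_quad assms(1)]]
    by (auto simp: bounded_iff)
  ultimately show ?thesis
    using measurable_restrict_space1[OF borel_measurable_quad, of A]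
    by (intro integrable_const_bound[of _ B] AE_I2) (auto simp: measurable_cong_sets[OF assms(3) refl])
qed

lemma integral_quad_entry:
  assumes "integrable \<mu> quad"
  shows "integrable \<mu> (\<lambda>s. quad s $ a $ b $ c $ d)"
    and "(\<integral>s. quad s $ a $ b $ c $ d \<partial>\<mu>) = (\<integral>s. quad s \<partial>\<mu>) $ a $ b $ c $ d"
proof -
  have "bounded_linear (\<lambda>v :: complex ^ 2 ^ 2 ^ 2 ^ 2. v $ a $ b $ c $ d)"
    by (rule bounded_linear_compose[OF bounded_linear_vec_nth
        bounded_linear_compose[OF bounded_linear_vec_nth
          bounded_linear_compose[OF bounded_linear_vec_nth bounded_linear_vec_nth]]])
  then show "integrable \<mu> (\<lambda>s. quad s $ a $ b $ c $ d)"
    and "(\<integral>s. quad s $ a $ b $ c $ d \<partial>\<mu>) = (\<integral>s. quad s \<partial>\<mu>) $ a $ b $ c $ d"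
    using assms by (auto intro: integrable_bounded_linear integral_bounded_linear)
qed

text \<open>The players randomise independently: in each monomial the factors depend on different
  coordinates of the product measure, so by Fubini the integral of the product is the product of the
  integrals.\<close>

lemma integral_multilinear_form_quad:
  fixes \<mu> :: "'n::finite \<Rightarrow> (complex ^ 2 ^ 2) measure"
  assumes "\<And>j. prob_space (\<mu> j)" "\<And>j. integrable (\<mu> j) quad"
  shows "(\<integral>s. multilinear_form C (\<lambda>j. quad (s j)) \<partial>(\<Pi>\<^sub>M j\<in>UNIV. \<mu> j)) =
    multilinear_form C (\<lambda>j. \<integral>s. quad s \<partial>\<mu> j)"
proof -
  interpret product_sigma_finite \<mu>
    using assms(1) by (simp add: product_sigma_finite_def prob_space_imp_sigma_finite)
  have int: "integrable (\<Pi>\<^sub>M j\<in>UNIV. \<mu> j) (\<lambda>s. \<Prod>j\<in>UNIV. quad (s j) $ (a $ j) $ (b $ j) $ (c $ j) $ (d $ j))"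
    for a b c d :: "2 ^ 'n"
    by (rule product_integrable_prod) (auto intro: integral_quad_entry assms(2))
  have "(\<integral>s. (\<Prod>j\<in>UNIV. quad (s j) $ (a $ j) $ (b $ j) $ (c $ j) $ (d $ j)) \<partial>(\<Pi>\<^sub>M j\<in>UNIV. \<mu> j)) =
      (\<Prod>j\<in>UNIV. (\<integral>s. quad s \<partial>\<mu> j) $ (a $ j) $ (b $ j) $ (c $ j) $ (d $ j))"
    for a b c d :: "2 ^ 'n"
    by (subst product_integral_prod) (auto simp: integral_quad_entry[OF assms(2)])
  then show ?thesis
    unfolding multilinear_form_def
    by (subst integral_Re) (simp_all add: int)
qed

section \<open>Outcome probabilities and payoffs as multilinear forms\<close>

lemma dagger_mult: "dagger (A ** B) = dagger B ** dagger A"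
  by (simp add: dagger_def matrix_matrix_mult_def vec_eq_iff mult.commute)

lemma dagger_tensor: "dagger (tensor U) $ x $ y = cnj (\<Prod>i\<in>UNIV. U i $ (y $ i) $ (x $ i))"
  by (simp add: dagger_def tensor_def)

text \<open>By cyclicity of the trace, \<open>tr (T H U J \<rho> J\<^sup>\<dagger> U\<^sup>\<dagger> H\<^sup>\<dagger>) = tr ((H\<^sup>\<dagger> T H) U (J \<rho> J\<^sup>\<dagger>) U\<^sup>\<dagger>)\<close>.\<close>

lemma outcome_prob_multilinear:
  fixes P :: "'n::finite ewl"
  shows "\<exists>C. \<forall>U. outcome_prob P U y = multilinear_form C (\<lambda>j. quad (U j))"
proof -
  define L where "L = dagger (post_op P) ** tensor (\<lambda>i. basis_projector (y $ i)) ** post_op P"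
  define R where "R = pre_op P ** init_state P ** dagger (pre_op P)"
  \<comment> \<open>In the trace of \<open>L U R U\<^sup>\<dagger>\<close>, \<open>a\<close> and
    \<open>b\<close> index the entry of \<open>U\<close>, \<open>c\<close> and \<open>d\<close> that
    of its conjugate; \<open>L\<close> and \<open>R\<close> supply the coefficient.\<close>
  have "outcome_prob P U y = multilinear_form (\<lambda>a b c d. L $ c $ a * R $ b $ d) (\<lambda>j. quad (U j))" for U
  proof -
    have "trace (tensor (\<lambda>i. basis_projector (y $ i)) ** final_state P U) =
        trace ((tensor (\<lambda>i. basis_projector (y $ i)) ** post_op P ** tensor U ** R ** dagger (tensor U))
          ** dagger (post_op P))"
      by (simp add: final_state_def Let_def R_def dagger_mult matrix_mul_assoc)
    also have "\<dots> = trace (dagger (post_op P) **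
        (tensor (\<lambda>i. basis_projector (y $ i)) ** post_op P ** tensor U ** R ** dagger (tensor U)))"
      by (rule trace_mul_sym)
    also have "\<dots> = trace ((L ** tensor U) ** (R ** dagger (tensor U)))"
      by (simp add: L_def matrix_mul_assoc)
    also have "\<dots> = (\<Sum>c\<in>UNIV. \<Sum>b\<in>UNIV. \<Sum>d\<in>UNIV. \<Sum>a\<in>UNIV.
        L $ c $ a * tensor U $ a $ b * (R $ b $ d * dagger (tensor U) $ d $ c))"
      by (simp add: trace_def matrix_matrix_mult_def sum_distrib_left sum_distrib_right)
    \<comment> \<open>Adjacent swaps turn the summation order \<open>c b d a\<close> into the order
      \<open>a b c d\<close> of \<open>multilinear_form\<close>.\<close>
    also have "\<dots> = (\<Sum>c\<in>UNIV. \<Sum>b\<in>UNIV. \<Sum>a\<in>UNIV. \<Sum>d\<in>UNIV.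
        L $ c $ a * tensor U $ a $ b * (R $ b $ d * dagger (tensor U) $ d $ c))"
      by (intro sum.cong refl sum.swap)
    also have "\<dots> = (\<Sum>c\<in>UNIV. \<Sum>a\<in>UNIV. \<Sum>b\<in>UNIV. \<Sum>d\<in>UNIV.
        L $ c $ a * tensor U $ a $ b * (R $ b $ d * dagger (tensor U) $ d $ c))"
      by (intro sum.cong refl sum.swap)
    also have "\<dots> = (\<Sum>a\<in>UNIV. \<Sum>c\<in>UNIV. \<Sum>b\<in>UNIV. \<Sum>d\<in>UNIV.
        L $ c $ a * tensor U $ a $ b * (R $ b $ d * dagger (tensor U) $ d $ c))"
      by (rule sum.swap)
    also have "\<dots> = (\<Sum>a\<in>UNIV. \<Sum>b\<in>UNIV. \<Sum>c\<in>UNIV. \<Sum>d\<in>UNIV.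
        L $ c $ a * tensor U $ a $ b * (R $ b $ d * dagger (tensor U) $ d $ c))"
      by (intro sum.cong refl sum.swap)
    also have "\<dots> = (\<Sum>a\<in>UNIV. \<Sum>b\<in>UNIV. \<Sum>c\<in>UNIV. \<Sum>d\<in>UNIV.
        L $ c $ a * R $ b $ d * (\<Prod>j\<in>UNIV. quad (U j) $ (a $ j) $ (b $ j) $ (c $ j) $ (d $ j)))"
      by (intro sum.cong refl) (simp add: dagger_tensor, simp add: tensor_def quad_def prod.distrib)
    finally show ?thesis
      unfolding outcome_prob_def multilinear_form_def by simp
  qed
  then show ?thesis by blast
qed

text \<open>A real combination of multilinear forms is again one: the evaluations are absorbed into
  the coefficients.\<close>

lemma expected_evaluation_multilinear:
  fixes P :: "'n::finite ewl"
  shows "\<exists>C. \<forall>U. expected_evaluation F P i U = multilinear_form C (\<lambda>j. quad (U j))"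
proof -
  obtain C where C: "\<And>y U. outcome_prob P U y = multilinear_form (C y) (\<lambda>j. quad (U j))"
    using outcome_prob_multilinear[of P] by metis
  have "expected_evaluation F P i U =
      multilinear_form (\<lambda>a b c d. \<Sum>y\<in>outputs F. evaluation F i None y * C y a b c d) (\<lambda>j. quad (U j))" for U
  proof -
    have "expected_evaluation F P i U =
      Re (\<Sum>y\<in>outputs F. \<Sum>a\<in>UNIV. \<Sum>b\<in>UNIV. \<Sum>c\<in>UNIV. \<Sum>d\<in>UNIV. evaluation F i None y * C y a b c d *
         (\<Prod>j\<in>UNIV. quad (U j) $ (a $ j) $ (b $ j) $ (c $ j) $ (d $ j)))"
      unfolding expected_evaluation_def C multilinear_form_def Re_sum
      by (simp add: sum_distrib_left mult.assoc)
    also have "\<dots> = Re (\<Sum>a\<in>UNIV. \<Sum>b\<in>UNIV. \<Sum>c\<in>UNIV. \<Sum>d\<in>UNIV. \<Sum>y\<in>outputs F. evaluation F i None y * C y a b c d *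
         (\<Prod>j\<in>UNIV. quad (U j) $ (a $ j) $ (b $ j) $ (c $ j) $ (d $ j)))"
      by (simp only: sum.swap[of _ _ "outputs F"])
    finally show ?thesis
      by (simp add: multilinear_form_def sum_distrib_right)
  qed
  then show ?thesis by blast
qed

section \<open>The implemented game and its equilibrium\<close>

theorem proposition1:
  fixes F :: "(2, 'n::finite) scenario" and P :: "'n ewl"
  assumes "no_input F"
    and "ewl_procedure P"
  shows "\<exists>G :: ('n, complex ^ 2 ^ 2) static_game.
           implements P F G \<and>
           (finite_game G \<or> continuous_game G) \<and>
           (\<exists>\<mu>. nash_equilibrium G \<mu>)"
proof -
  define M where "M = moves P"
  have M: "compact M" "M \<noteq> {}"
    using assms(2) by (auto simp: M_def ewl_procedure_def)
  \<comment> \<open>The admissible operators themselves serve as strategies, so the representation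
    is the identity.\<close>
  define G :: "('n, complex ^ 2 ^ 2) static_game"
    where "G = \<lparr>strategies = \<lambda>_. M, payoff = expected_evaluation F P\<rparr>"
  obtain C where C: "\<And>i U. expected_evaluation F P i U = multilinear_form (C i) (\<lambda>j. quad (U j))"
    using expected_evaluation_multilinear[of F P] by metis
  have "homeomorphism M M (\<lambda>s. s) (\<lambda>s. s)"
    by (simp add: homeomorphism_def)
  then have impl: "implements P F G"
    unfolding implements_def G_def M_def
    by (intro exI[of _ "\<lambda>_ s. s"]) auto
  have "continuous_on (profiles G) (expected_evaluation F P i)" for i
    unfolding C
    by (rule continuous_on_compose2[OF continuous_on_multilinear_form[of UNIV]])
      (auto intro!: continuous_on_coordinatewise_then_product
        continuous_on_compose2[OF continuous_on_quad[of UNIV]]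
        continuous_on_subset[OF continuous_on_product_coordinates])
  \<comment> \<open>All players share the set \<open>M\<close>, so the strategy sets are either all
    finite or all infinite.\<close>
  then have fc: "finite_game G \<or> continuous_game G"
    using M by (auto simp: finite_game_def continuous_game_def G_def)
  have "compact (convex hull (quad ` M))"
    by (intro compact_convex_hull compact_continuous_image continuous_on_quad M)
  then obtain X where X: "\<And>i. X i \<in> convex hull (quad ` M)"
      "\<And>i v. v \<in> convex hull (quad ` M) \<Longrightarrow> multilinear_form (C i) (X(i := v)) \<le> multilinear_form (C i) X"
    using linear_payoff_equilibrium[of "\<lambda>_. convex hull (quad ` M)" "\<lambda>i. multilinear_form (C i)"]
    by (auto simp: M continuous_on_multilinear_form linear_multilinear_form)
  \<comment> \<open>The equilibrium on the convex hull is lifted to mixed strategies with the same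
    barycentres.\<close>
  obtain \<mu> where \<mu>: "\<And>j. mixed_strategy G j (\<mu> j)" "\<And>j. (\<integral>s. quad s \<partial>\<mu> j) = X j"
    using convex_hull_barycentre[OF X(1) borel_measurable_quad]
    unfolding mixed_strategy_def G_def by simp metis
  have mixed: "prob_space \<nu> \<and> integrable \<nu> quad \<and> space \<nu> = M" if "mixed_strategy G i \<nu>" for i \<nu>
    using that integrable_quad[OF M(1), of \<nu>]
    by (auto simp: mixed_strategy_def G_def space_restrict_space dest: sets_eq_imp_space_eq)
  have payoff: "mixed_payoff G i \<nu> = multilinear_form (C i) (\<lambda>j. \<integral>s. quad s \<partial>\<nu> j)"
    if "\<And>j. mixed_strategy G j (\<nu> j)" for i \<nu>
  proof -
    have "payoff G i = (\<lambda>s. multilinear_form (C i) (\<lambda>j. quad (s j)))"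
      by (simp add: G_def C fun_eq_iff)
    then show ?thesis
      using mixed[OF that] by (simp add: mixed_payoff_def integral_multilinear_form_quad)
  qed
  have "mixed_payoff G i (\<mu>(i := \<nu>)) \<le> mixed_payoff G i \<mu>" if \<nu>: "mixed_strategy G i \<nu>" for i \<nu>
  proof -
    interpret prob_space \<nu> using mixed[OF \<nu>] by simp
    have bl: "bounded_linear (\<lambda>v. multilinear_form (C i) (X(i := v)))"
      by (intro linear_conv_bounded_linear[THEN iffD1] linear_multilinear_form)
    have upd: "(\<lambda>j. \<integral>s. quad s \<partial>(\<mu>(i := \<nu>)) j) = X(i := \<integral>s. quad s \<partial>\<nu>)"
      by (auto simp: \<mu>(2))
    have "mixed_payoff G i (\<mu>(i := \<nu>)) = multilinear_form (C i) (X(i := \<integral>s. quad s \<partial>\<nu>))"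
      unfolding upd[symmetric] using \<mu>(1) \<nu> by (intro payoff) simp
    \<comment> \<open>Pulling the integral out by linearity reduces a mixed deviation to pure ones,
      whose \<open>quad s\<close> lie in the convex hull. Thus the barycentre of \<nu> does not have
      to be located there.\<close>
    also have "\<dots> = (\<integral>s. multilinear_form (C i) (X(i := quad s)) \<partial>\<nu>)"
      using mixed[OF \<nu>] by (intro integral_bounded_linear[OF bl, symmetric]) simp
    also have "\<dots> \<le> multilinear_form (C i) X"
      using mixed[OF \<nu>]
      by (intro integral_le_const integrable_bounded_linear[OF bl] AE_I2 X(2) hull_inc) auto
    also have "\<dots> = mixed_payoff G i \<mu>"
      by (simp add: payoff \<mu>)
    finally show ?thesis .
  qed
  then have "nash_equilibrium G \<mu>"
    using \<mu>(1) by (simp add: nash_equilibrium_def)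
  with impl fc show ?thesis by blast
qed

end
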